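(* Let $\mu>0$, $\tau>0$, and let $f:[0,\infty)\to[0,\infty)$ be a continuous function satisfying condition (U) with critical point $x_0$. Put $g=\mu^{-1}f$, suppose $g'(0)>1$, and suppose that the unique positive fixed point $K$ of $g$ satisfies $K>x_0$. Define $$g_1(x)=\left(1-e^{-\mu\tau}\right)g(x)+e^{-\mu\tau}K,\qquad x\ge 0,$$ and assume that $g_1(g_1(x_0))>x_0$. Then every solution of $$x'(t)=-\mu x(t)+f(x(t-\tau))$$ with nonnegative, not identically zero initial function enters the domain where $f'$ is negative; that is, for every nonnegative $\phi\in C([-\tau,0],\mathbb{R})$ with $\phi\not\equiv 0$, the solution $x$ with $x=\phi$ on $[-\tau,0]$ satisfies $x(t)>x_0$ for all sufficiently large $t$.
   Context: Condition (U): $f(x)\ge 0$ for all $x\ge 0$, $f(0)=0$, and there is a unique $x_0>0$ such that $f'(x)>0$ if $0\le x<x_0$, $f'(x_0)=0$, and $f'(x)<0$ if $x>x_0$; moreover $f''(x)<0$ for $0\le x\le x_0$. Under (U) with $g'(0)>1$, the fixed points of $g$ are exactly $0$ and one positive point $K$. For each nonnegative, not identically zero $\phi\in C([-\tau,0],\mathbb{R})$ the equation has a unique solution, defined for all $t\ge-\tau$, with $x=\phi$ on $[-\tau,0]$. *)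

theory Defs
  imports "HOL-Analysis.Analysis"
begin

text \<open>Functions on the half-line \<open>[0, \<infinity>)\<close> are represented by total functions on the reals;
  their values at negative arguments are irrelevant. Derivatives are therefore taken within
  \<open>{0..}\<close>: one-sided at \<open>0\<close> and the usual two-sided ones at positive points.\<close>

definition half_deriv :: "(real \<Rightarrow> real) \<Rightarrow> real \<Rightarrow> real" where
  "half_deriv f x = vector_derivative f (at x within {0..})"

lemma half_deriv_eq:
  assumes "(f has_real_derivative D) (at x within {0..})" and "0 \<le> x"
  shows "half_deriv f x = D"
proof -
  have "at x within {x..} \<noteq> bot"
    by (simp add: at_within_Ici_at_right)
  moreover have "at x within {x..} \<le> at x within {0..}"
    using assms(2) by (intro at_le) auto
  ultimately have nb: "at x within {0..} \<noteq> bot"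
    by (metis bot.extremum_uniqueI)
  show ?thesis
    unfolding half_deriv_def
    using assms(1) nb
    by (intro vector_derivative_within) (auto simp: has_real_derivative_iff_has_vector_derivative)
qed

definition unimodal_critical_point :: "(real \<Rightarrow> real) \<Rightarrow> real \<Rightarrow> bool" where
  "unimodal_critical_point f c \<longleftrightarrow>
     c > 0 \<and>
     (\<forall>x. 0 \<le> x \<and> x < c \<longrightarrow> half_deriv f x > 0) \<and>
     half_deriv f c = 0 \<and>
     (\<forall>x. x > c \<longrightarrow> half_deriv f x < 0)"

text \<open>Condition (U), with \<open>x0\<close> the unique critical point. The differentiability clauses make
  explicit the existence of the derivatives whose signs are prescribed.\<close>

definition condition_U :: "(real \<Rightarrow> real) \<Rightarrow> real \<Rightarrow> bool" where
  "condition_U f x0 \<longleftrightarrow>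
     (\<forall>x\<ge>0. f x \<ge> 0) \<and> f 0 = 0 \<and>
     (\<forall>x\<ge>0. f differentiable (at x within {0..})) \<and>
     (\<forall>c. unimodal_critical_point f c \<longleftrightarrow> c = x0) \<and>
     (\<forall>x\<in>{0..x0}. half_deriv f differentiable (at x within {0..}) \<and>
                  half_deriv (half_deriv f) x < 0)"

definition gmap :: "real \<Rightarrow> (real \<Rightarrow> real) \<Rightarrow> real \<Rightarrow> real" where
  "gmap \<mu> f x = inverse \<mu> * f x"

definition g1map :: "real \<Rightarrow> real \<Rightarrow> (real \<Rightarrow> real) \<Rightarrow> real \<Rightarrow> real \<Rightarrow> real" where
  "g1map \<mu> \<tau> f K x = (1 - exp (- \<mu> * \<tau>)) * gmap \<mu> f x + exp (- \<mu> * \<tau>) * K"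

text \<open>For nonnegative \<open>\<phi>\<close> and \<open>f\<close> nonnegative on \<open>{0..}\<close>, a function satisfying this predicate
  is automatically nonnegative on \<open>{-\<tau>..}\<close> (method of steps), so \<open>f\<close> is only ever
  evaluated on \<open>{0..}\<close>.\<close>

definition dde_solution ::
  "real \<Rightarrow> real \<Rightarrow> (real \<Rightarrow> real) \<Rightarrow> (real \<Rightarrow> real) \<Rightarrow> (real \<Rightarrow> real) \<Rightarrow> bool" where
  "dde_solution \<mu> \<tau> f \<phi> x \<longleftrightarrow>
     continuous_on {-\<tau>..} x \<and>
     (\<forall>t\<in>{-\<tau>..0}. x t = \<phi> t) \<and>
     (\<forall>t>0. (x has_real_derivative (- \<mu> * x t + f (x (t - \<tau>)))) (at t))"

end

theory Submission
  imports Defs "HOL-Real_Asymp.Real_Asymp"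
begin

text \<open>Write the equation as \<open>x' = \<mu> (g (x (t - \<tau>)) - x t)\<close>: the solution relaxes exponentially, at
  rate \<open>\<mu>\<close>, towards the delayed target \<open>g (x (t - \<tau>))\<close>. Everything rests on one comparison principle
  (\<open>relaxation_lower\<close>): while the target stays above \<open>c\<close>, the gap \<open>x - c\<close> cannot decrease faster
  than \<open>exp (- \<mu> t)\<close>.

  The number \<open>g1 y = g y + exp (- \<mu> \<tau>) (K - g y)\<close>, called \<open>damped y\<close> below, is the position
  reached from \<open>K\<close> by relaxing for one delay towards \<open>g y\<close>. An excursion of \<open>x\<close> to one side of
  \<open>K\<close> is exposed to values of \<open>g\<close> from the other side of \<open>K\<close> during its first delay only:
  afterwards the delayed value lies in the excursion itself, and there a better bound on the
  target is available (\<open>excursion_lower\<close>): the target is at most \<open>K\<close> during an upward excursion,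
  and at least \<open>min (g a) K\<close> during a downward excursion that stays above some \<open>a \<le> x0\<close>.

  Above \<open>K\<close> this gives the bound \<open>P = g1 x0\<close>, since \<open>g \<le> g x0\<close>; the only exceptions are
  solutions that eventually exceed \<open>K\<close> for good, and for these nothing is left to prove
  (\<open>eventually_le_damped_peak\<close>).
  Below \<open>K\<close>, suppose that eventually \<open>a \<le> x \<le> P\<close> with \<open>0 < a \<le> x0\<close>. By unimodality the target is
  at least \<open>min (g a) (g P)\<close>, so that \<open>x\<close> eventually exceeds every number below
  \<open>min (g a) (min (g1 a) (g1 P))\<close> (\<open>lower_bound_improves\<close>). On \<open>(0, K)\<close> both \<open>g a\<close> and \<open>g1 a\<close> are
  larger than \<open>a\<close>, and \<open>g1 P > x0\<close> is the hypothesis of the theorem; hence no lower limit in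
  \<open>(0, x0]\<close> survives this improvement. That the lower limit is positive is the persistence
  statement \<open>eventually_bounded_away_from_zero\<close>.\<close>

section \<open>Linear relaxation towards a moving target\<close>

text \<open>The function \<open>exp (\<mu> u) (y u - c)\<close> has derivative \<open>\<mu> exp (\<mu> u) (b u - c) \<ge> 0\<close>.\<close>

lemma relaxation_lower:
  fixes y b :: "real \<Rightarrow> real"
  assumes "\<mu> > 0" "s \<le> t" and cont: "continuous_on {s..t} y"
    and der: "\<And>u. s < u \<Longrightarrow> u < t \<Longrightarrow> (y has_real_derivative \<mu> * (b u - y u)) (at u)"
    and low: "\<And>u. s < u \<Longrightarrow> u < t \<Longrightarrow> c \<le> b u"
  shows "c + exp (- \<mu> * (t - s)) * (y s - c) \<le> y t"
proof -
  have "exp (\<mu> * s) * (y s - c) \<le> exp (\<mu> * t) * (y t - c)"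
  proof (rule DERIV_nonneg_imp_increasing_open[OF \<open>s \<le> t\<close>])
    show "continuous_on {s..t} (\<lambda>u. exp (\<mu> * u) * (y u - c))"
      by (intro continuous_intros cont)
    fix u assume u: "s < u" "u < t"
    have "((\<lambda>u. exp (\<mu> * u) * (y u - c)) has_real_derivative
        exp (\<mu> * u) * \<mu> * (y u - c) + exp (\<mu> * u) * (\<mu> * (b u - y u))) (at u)"
      by (auto intro!: derivative_eq_intros der[OF u])
    moreover have "exp (\<mu> * u) * \<mu> * (y u - c) + exp (\<mu> * u) * (\<mu> * (b u - y u)) =
        exp (\<mu> * u) * \<mu> * (b u - c)"
      by (simp add: algebra_simps)
    moreover have "exp (\<mu> * u) * \<mu> * (b u - c) \<ge> 0"
      using low[OF u] \<open>\<mu> > 0\<close> by simp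
    ultimately show "\<exists>D. ((\<lambda>u. exp (\<mu> * u) * (y u - c)) has_real_derivative D) (at u) \<and> 0 \<le> D"
      by auto
  qed
  then have "exp (- \<mu> * t) * (exp (\<mu> * s) * (y s - c)) \<le>
      exp (- \<mu> * t) * (exp (\<mu> * t) * (y t - c))"
    by (intro mult_left_mono) auto
  moreover have "exp (- \<mu> * (t - s)) = exp (- \<mu> * t) * exp (\<mu> * s)"
    by (simp add: algebra_simps flip: exp_add)
  moreover have "exp (- \<mu> * t) * (exp (\<mu> * t) * (y t - c)) = y t - c"
    by (simp add: exp_minus)
  ultimately show ?thesis
    by (simp only: mult.assoc)
qed

text \<open>The times at which \<open>y\<close> is at least \<open>K\<close> form a compact set, whose maximum is the start of
  the excursion below \<open>K\<close> that is under way at time \<open>t\<close>.\<close>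

lemma last_time_above:
  fixes y :: "real \<Rightarrow> real"
  assumes "s \<le> t" and cont: "continuous_on {s..t} y" and "K \<le> y s" "y t < K"
  obtains r where "s \<le> r" "r < t" "K \<le> y r" "\<And>u. r < u \<Longrightarrow> u \<le> t \<Longrightarrow> y u < K"
proof -
  define A where "A = {s..t} \<inter> y -` {K..}"
  have "closed A"
    unfolding A_def by (intro continuous_closed_preimage cont) auto
  from compact_Int_closed[OF compact_Icc this, of s t] have "compact A"
    by (simp add: A_def)
  moreover have "A \<noteq> {}"
    using assms unfolding A_def by force
  ultimately obtain r where r: "r \<in> A" "\<And>u. u \<in> A \<Longrightarrow> u \<le> r"
    using compact_attains_sup[of A] by auto
  show thesis
  proof (rule that)
    show r_bounds: "s \<le> r" "K \<le> y r" using r(1) by (auto simp: A_def)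
    have "r \<le> t" "r \<noteq> t" using r(1) \<open>y t < K\<close> by (auto simp: A_def)
    then show "r < t" by simp
    show "y u < K" if "r < u" "u \<le> t" for u
    proof (rule ccontr)
      assume "\<not> y u < K"
      with that r_bounds have "u \<in> A" by (simp add: A_def)
      from r(2)[OF this] \<open>r < u\<close> show False by simp
    qed
  qed
qed

text \<open>During the first delay of an excursion below \<open>K\<close>, the level \<open>d\<close> holds because \<open>y\<close> has not
  had the time to relax further from \<open>K\<close> towards the bound \<open>c\<close> of its target. From then on the
  delayed value is itself below \<open>K\<close>, so that the target is at least \<open>c'\<close> and the level
  \<open>d \<le> c'\<close> cannot be crossed any more. Applied to \<open>- y\<close>, this also controls excursions above a
  level.\<close>

lemma excursion_lower:
  fixes y b :: "real \<Rightarrow> real"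
  assumes "\<mu> > 0" "\<tau> > 0" "s \<le> t" and cont: "continuous_on {s..t} y"
    and der: "\<And>u. s < u \<Longrightarrow> u < t \<Longrightarrow> (y has_real_derivative \<mu> * (b u - y u)) (at u)"
    and start: "K \<le> y s" and "c \<le> K"
    and low: "\<And>u. s < u \<Longrightarrow> u < t \<Longrightarrow> c \<le> b u"
    and delayed: "\<And>u. s + \<tau> < u \<Longrightarrow> u < t \<Longrightarrow> y (u - \<tau>) \<le> K \<Longrightarrow> c' \<le> b u"
    and d: "d \<le> c'" "d \<le> c + exp (- \<mu> * \<tau>) * (K - c)"
  shows "d \<le> y t"
proof (cases "K \<le> y t")
  case True
  have "exp (- \<mu> * \<tau>) * (K - c) \<le> 1 * (K - c)"
    using assms(1,2) \<open>c \<le> K\<close> by (intro mult_right_mono) auto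
  with d True show ?thesis by simp
next
  case False
  then obtain r where r: "s \<le> r" "r < t" "K \<le> y r" "\<And>u. r < u \<Longrightarrow> u \<le> t \<Longrightarrow> y u < K"
    using last_time_above[OF \<open>s \<le> t\<close> cont start] by (metis not_le)
  have first_delay: "d \<le> y v" if v: "r \<le> v" "v \<le> t" "v \<le> r + \<tau>" for v
  proof -
    have "exp (- \<mu> * \<tau>) * (K - c) \<le> exp (- \<mu> * (v - r)) * (y r - c)"
      using assms(1) v r \<open>c \<le> K\<close> by (intro mult_mono) auto
    moreover have "c + exp (- \<mu> * (v - r)) * (y r - c) \<le> y v"
      using r v by (intro relaxation_lower[where b = b] continuous_on_subset[OF cont] der low assms(1)) auto
    ultimately show ?thesis using d by simp
  qed
  show ?thesis
  proof (cases "t \<le> r + \<tau>")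
    case True
    then show ?thesis using first_delay[of t] r by simp
  next
    case False
    have "d + exp (- \<mu> * (t - (r + \<tau>))) * (y (r + \<tau>) - d) \<le> y t"
    proof (intro relaxation_lower[where b = b] continuous_on_subset[OF cont] der assms(1))
      fix u assume u: "r + \<tau> < u" "u < t"
      then have "y (u - \<tau>) < K" using r(4)[of "u - \<tau>"] \<open>\<tau> > 0\<close> by simp
      then show "d \<le> b u" using delayed[of u] u r d by simp
    qed (use False r \<open>\<tau> > 0\<close> in auto)
    moreover have "0 \<le> exp (- \<mu> * (t - (r + \<tau>))) * (y (r + \<tau>) - d)"
      using first_delay[of "r + \<tau>"] False \<open>\<tau> > 0\<close> by simp
    ultimately show ?thesis by simp
  qed
qed

section \<open>Delayed unimodal feedback\<close>

text \<open>What the argument uses of condition (U) is the shape of \<open>g\<close> and the position of its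
  graph relative to the diagonal; the derivatives of \<open>f\<close> serve to establish these facts.\<close>

locale unimodal_delay =
  fixes \<mu> \<tau> x0 K :: real and g x :: "real \<Rightarrow> real"
  assumes mu: "\<mu> > 0" and tau: "\<tau> > 0" and x0_pos: "0 < x0" and x0_less_K: "x0 < K"
    and g_cont: "continuous_on {0..} g"
    and g_nonneg: "\<And>y. 0 \<le> y \<Longrightarrow> 0 \<le> g y"
    and g_pos: "\<And>y. 0 < y \<Longrightarrow> 0 < g y"
    and g_incr: "\<And>y z. 0 \<le> y \<Longrightarrow> y \<le> z \<Longrightarrow> z \<le> x0 \<Longrightarrow> g y \<le> g z"
    and g_decr: "\<And>y z. x0 \<le> y \<Longrightarrow> y \<le> z \<Longrightarrow> g z \<le> g y"
    and g_K: "g K = K"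
    and g_above: "\<And>y. 0 < y \<Longrightarrow> y < K \<Longrightarrow> y < g y"
    and x_cont: "continuous_on {-\<tau>..} x"
    and x_init: "\<And>t. -\<tau> \<le> t \<Longrightarrow> t \<le> 0 \<Longrightarrow> 0 \<le> x t"
    and x_nontrivial: "\<exists>t\<in>{-\<tau>..0}. x t \<noteq> 0"
    and x_der: "\<And>t. 0 < t \<Longrightarrow> (x has_real_derivative \<mu> * (g (x (t - \<tau>)) - x t)) (at t)"
begin

definition damped :: "real \<Rightarrow> real" where
  "damped y = g y + exp (- \<mu> * \<tau>) * (K - g y)"

lemma g_le_peak: "0 \<le> y \<Longrightarrow> g y \<le> g x0"
  using g_incr[of y x0] g_decr[of x0 y] x0_pos by linarith

lemma g_le_K: "K \<le> y \<Longrightarrow> g y \<le> K"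
  using g_decr[of K y] x0_less_K g_K by simp

lemma g_ge_min_ends: "0 \<le> a \<Longrightarrow> a \<le> y \<Longrightarrow> y \<le> p \<Longrightarrow> min (g a) (g p) \<le> g y"
  using g_incr[of a y] g_decr[of y p] by linarith

lemma K_le_peak: "K \<le> g x0"
  using g_le_peak[of K] g_K x0_pos x0_less_K by simp

lemma relaxation_factor: "0 < exp (- \<mu> * \<tau>)" "exp (- \<mu> * \<tau>) < 1"
  using mu tau by auto

lemma damped_convex: "damped y = (1 - exp (- \<mu> * \<tau>)) * g y + exp (- \<mu> * \<tau>) * K"
  by (simp add: damped_def algebra_simps)

lemma damped_le_K: "g y \<le> K \<Longrightarrow> damped y \<le> K"
  using mult_right_mono[of "exp (- \<mu> * \<tau>)" 1 "K - g y"] relaxation_factor by (simp add: damped_def)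

lemma K_le_damped: "K \<le> g y \<Longrightarrow> K \<le> damped y"
  using mult_right_mono[of "exp (- \<mu> * \<tau>)" 1 "g y - K"] relaxation_factor
  by (simp add: damped_def algebra_simps)

lemma less_damped:
  assumes "z < g y" "z < K" shows "z < damped y"
proof -
  have "(1 - exp (- \<mu> * \<tau>)) * z < (1 - exp (- \<mu> * \<tau>)) * g y"
    using relaxation_factor assms by (intro mult_strict_left_mono) auto
  moreover have "exp (- \<mu> * \<tau>) * z < exp (- \<mu> * \<tau>) * K"
    using relaxation_factor assms by (intro mult_strict_left_mono) auto
  ultimately show ?thesis
    unfolding damped_convex left_diff_distrib by linarith
qed

lemma x_cont_on: "-\<tau> \<le> s \<Longrightarrow> continuous_on {s..t} x"
  by (rule continuous_on_subset[OF x_cont]) auto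

lemma solution_relaxes_lower:
  assumes "0 \<le> s" "s \<le> t" "\<And>u. s < u \<Longrightarrow> u < t \<Longrightarrow> c \<le> g (x (u - \<tau>))"
  shows "c + exp (- \<mu> * (t - s)) * (x s - c) \<le> x t"
  using assms mu tau
  by (intro relaxation_lower[where b = "\<lambda>u. g (x (u - \<tau>))"] x_cont_on x_der) auto

section \<open>Dissipativity and persistence\<close>

text \<open>The method of steps: a level that the solution respects during one delay, and that the
  target then respects as well, is respected during the next delay.\<close>

lemma lower_level_invariant:
  assumes "0 \<le> T" and init: "\<And>u. T - \<tau> \<le> u \<Longrightarrow> u \<le> T \<Longrightarrow> d \<le> x u"
    and inv: "\<And>u. T < u \<Longrightarrow> d \<le> x (u - \<tau>) \<Longrightarrow> d \<le> g (x (u - \<tau>))"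
    and "T - \<tau> \<le> t"
  shows "d \<le> x t"
proof -
  have steps: "\<forall>u. T - \<tau> \<le> u \<and> u \<le> T + real n * \<tau> \<longrightarrow> d \<le> x u" for n
  proof (induction n)
    case 0
    then show ?case using init by simp
  next
    case (Suc n)
    show ?case
    proof (intro allI impI)
      fix u assume u: "T - \<tau> \<le> u \<and> u \<le> T + real (Suc n) * \<tau>"
      show "d \<le> x u"
      proof (cases "u \<le> T")
        case True
        then show ?thesis using init u by simp
      next
        case False
        have "d + exp (- \<mu> * (u - T)) * (x T - d) \<le> x u"
        proof (intro solution_relaxes_lower)
          fix v assume v: "T < v" "v < u"
          then have "v - \<tau> \<le> T + real n * \<tau>" "T - \<tau> \<le> v - \<tau>"
            using u by (auto simp: algebra_simps)
          then show "d \<le> g (x (v - \<tau>))" using Suc inv v by blast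
        qed (use False \<open>0 \<le> T\<close> in auto)
        moreover have "0 \<le> exp (- \<mu> * (u - T)) * (x T - d)"
          using init[of T] tau by simp
        ultimately show ?thesis by simp
      qed
    qed
  qed
  obtain n where "(t - T) / \<tau> \<le> real n"
    using real_arch_simple by blast
  then have "t \<le> T + real n * \<tau>"
    using tau by (simp add: field_simps)
  with steps \<open>T - \<tau> \<le> t\<close> show ?thesis by blast
qed

lemma x_nonneg: "-\<tau> \<le> t \<Longrightarrow> 0 \<le> x t"
  by (rule lower_level_invariant[of 0]) (auto intro: x_init g_nonneg)

text \<open>If \<open>x\<close> vanished on \<open>[0, \<infinity>)\<close>, then so would \<open>g (x (t - \<tau>))\<close> for \<open>t > 0\<close>, which
  forces the initial function to vanish.\<close>

lemma positive_somewhere: "\<exists>s\<ge>0. 0 < x s"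
proof (rule ccontr)
  assume "\<not> ?thesis"
  then have zero: "x t = 0" if "t \<ge> 0" for t
    using x_nonneg[of t] that tau by (auto simp: not_less intro: order_antisym)
  have interior: "x v = 0" if v: "v \<in> {-\<tau><..<0}" for v
  proof -
    have "v + \<tau> > 0" using v by simp
    have "\<mu> * (g (x (v + \<tau> - \<tau>)) - x (v + \<tau>)) = 0"
      using \<open>v + \<tau> > 0\<close> zero
      by (intro DERIV_local_const[OF x_der, of "v + \<tau>" "v + \<tau>"]) auto
    then have "g (x v) = 0" using mu zero \<open>v + \<tau> > 0\<close> by simp
    then show ?thesis using g_pos[of "x v"] x_nonneg[of v] v by fastforce
  qed
  have "x v = 0" if "v \<in> {-\<tau>..0}" for v
    using continuous_constant_on_closure[of "{-\<tau><..<0}" x 0 v] interior that tau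
      x_cont_on[of "-\<tau>" 0] by simp
  with x_nontrivial show False by blast
qed

lemma eventually_positive: "\<exists>s\<ge>0. \<forall>t\<ge>s. 0 < x t"
proof -
  obtain s where s: "0 \<le> s" "0 < x s" using positive_somewhere by blast
  have "0 < x t" if "s \<le> t" for t
  proof -
    have "0 + exp (- \<mu> * (t - s)) * (x s - 0) \<le> x t"
      using s that by (intro solution_relaxes_lower g_nonneg x_nonneg) auto
    moreover have "0 < exp (- \<mu> * (t - s)) * x s" using s by simp
    ultimately show ?thesis by simp
  qed
  with s show ?thesis by blast
qed

text \<open>The target never exceeds \<open>g x0\<close>, so the excess over \<open>g x0\<close> decays from its initial value.\<close>

lemma bounded_above: "\<exists>B\<ge>x0. \<forall>t\<ge>0. x t \<le> B"
proof (intro exI conjI allI impI)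
  show "x0 \<le> g x0 + x 0"
    using K_le_peak x0_less_K x_nonneg[of 0] tau by simp
  fix t :: real assume t: "0 \<le> t"
  have "- g x0 + exp (- \<mu> * (t - 0)) * (- x 0 - - g x0) \<le> - x t"
  proof (rule relaxation_lower[where b = "\<lambda>u. - g (x (u - \<tau>))"])
    show "continuous_on {0..t} (\<lambda>t. - x t)"
      using tau by (intro continuous_intros x_cont_on) auto
    fix u :: real assume "0 < u" "u < t"
    show "((\<lambda>t. - x t) has_real_derivative \<mu> * (- g (x (u - \<tau>)) - - x u)) (at u)"
      using DERIV_minus[OF x_der[OF \<open>0 < u\<close>]] by (simp add: algebra_simps)
    show "- g x0 \<le> - g (x (u - \<tau>))"
      using g_le_peak x_nonneg \<open>0 < u\<close> by simp
  qed (use t mu in auto)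
  moreover have "exp (- \<mu> * t) * x 0 \<le> 1 * x 0" "0 \<le> exp (- \<mu> * t) * g x0"
    using t mu tau x_nonneg[of 0] g_nonneg[of x0] x0_pos by (auto intro!: mult_left_le_one_le)
  ultimately show "x t \<le> g x0 + x 0"
    by (simp add: algebra_simps)
qed

text \<open>Given an upper bound \<open>B\<close> of the solution, delayed values in \<open>[\<delta>, B]\<close> give targets of at least
  \<open>min (g \<delta>) (g B)\<close>. This exceeds every sufficiently small \<open>\<delta>\<close>, because the graph of \<open>g\<close> lies
  above the diagonal near \<open>0\<close>; so such a level persists once it has held during one delay.\<close>

lemma eventually_bounded_away_from_zero: "\<exists>\<delta>>0. \<forall>\<^sub>F t in at_top. \<delta> \<le> x t"
proof -
  obtain s where s: "0 \<le> s" "\<And>t. s \<le> t \<Longrightarrow> 0 < x t" using eventually_positive by blast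
  obtain B where B: "x0 \<le> B" "\<And>t. 0 \<le> t \<Longrightarrow> x t \<le> B" using bounded_above by blast
  define T where "T = s + \<tau>"
  have "continuous_on {s..T} x" using s tau by (intro x_cont_on) auto
  then obtain v where v: "v \<in> {s..T}" "\<And>u. u \<in> {s..T} \<Longrightarrow> x v \<le> x u"
    using continuous_attains_inf[of "{s..T}" x] tau by (auto simp: T_def)
  define \<delta> where "\<delta> = min (x v) (min x0 (g B))"
  have pos: "0 < \<delta>"
    using s v x0_pos g_pos[of B] B by (auto simp: \<delta>_def)
  have "\<delta> \<le> x t" if "s \<le> t" for t
  proof (rule lower_level_invariant)
    show "0 \<le> T" "T - \<tau> \<le> t" using s tau that by (auto simp: T_def)
    show "\<delta> \<le> x u" if "T - \<tau> \<le> u" "u \<le> T" for u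
      using v(2)[of u] that by (auto simp: \<delta>_def T_def)
    show "\<delta> \<le> g (x (u - \<tau>))" if "T < u" "\<delta> \<le> x (u - \<tau>)" for u
    proof -
      have "x (u - \<tau>) \<le> B" using that s by (intro B) (auto simp: T_def)
      then have "min (g \<delta>) (g B) \<le> g (x (u - \<tau>))"
        using that pos by (intro g_ge_min_ends) auto
      moreover have "\<delta> < g \<delta>" using pos x0_less_K by (intro g_above) (auto simp: \<delta>_def)
      ultimately show ?thesis by (auto simp: \<delta>_def)
    qed
  qed
  then have "\<forall>\<^sub>F t in at_top. \<delta> \<le> x t" by (rule eventually_at_top_linorderI[of s])
  with pos show ?thesis by blast
qed

section \<open>Excursions around the equilibrium\<close>

text \<open>An upward excursion has the peak \<open>g x0\<close> as the upper bound of its target in the first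
  delay, and \<open>K\<close> from then on. A solution that is not eventually above \<open>K\<close> performs only
  such excursions.\<close>

lemma eventually_le_damped_peak:
  assumes "\<not> (\<forall>\<^sub>F t in at_top. K < x t)"
  shows "\<forall>\<^sub>F t in at_top. x t \<le> damped x0"
proof -
  obtain s where s: "0 \<le> s" "x s \<le> K"
    using assms unfolding eventually_at_top_linorder by (meson not_less)
  have "x t \<le> damped x0" if "s \<le> t" for t
  proof -
    have "- damped x0 \<le> - x t"
    proof (rule excursion_lower[where b = "\<lambda>u. - g (x (u - \<tau>))" and y = "\<lambda>t. - x t" and c' = "- K"
          and K = "- K" and c = "- g x0" and s = s])
      show "continuous_on {s..t} (\<lambda>t. - x t)"
        using tau s by (intro continuous_intros x_cont_on) auto
      show "((\<lambda>t. - x t) has_real_derivative \<mu> * (- g (x (u - \<tau>)) - - x u)) (at u)" if "s < u" for u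
        using DERIV_minus[OF x_der[of u]] s that by (simp add: algebra_simps)
      show "- g x0 \<le> - g (x (u - \<tau>))" if "s < u" for u
        using g_le_peak x_nonneg s that by simp
      show "- K \<le> - g (x (u - \<tau>))" if "- x (u - \<tau>) \<le> - K" for u
        using g_le_K that by simp
      show "- damped x0 \<le> - K" using K_le_damped K_le_peak by simp
      show "- damped x0 \<le> - g x0 + exp (- \<mu> * \<tau>) * (- K - - g x0)"
        by (simp add: damped_def algebra_simps)
    qed (use mu tau s that K_le_peak in auto)
    then show ?thesis by simp
  qed
  then show ?thesis by (rule eventually_at_top_linorderI[of s])
qed

text \<open>A solution that stays below \<open>K\<close> has its target above \<open>min (g a) K\<close> and relaxes towards
  it; the strict inequality for \<open>c\<close> absorbs the exponentially small remainder. Every other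
  solution returns to \<open>K\<close>, and its downward excursions are controlled by \<open>excursion_lower\<close>.\<close>

lemma lower_bound_improves:
  assumes up: "\<forall>\<^sub>F t in at_top. x t \<le> P" and "K \<le> P"
    and lo: "\<forall>\<^sub>F t in at_top. a \<le> x t" and a: "0 < a" "a \<le> x0"
    and c: "c < min (g a) (min (damped a) (damped P))"
  shows "\<forall>\<^sub>F t in at_top. c \<le> x t"
proof -
  obtain T where T: "0 \<le> T" "\<And>t. T \<le> t \<Longrightarrow> a \<le> x t" "\<And>t. T \<le> t \<Longrightarrow> x t \<le> P"
  proof -
    obtain T1 T2 where "\<forall>t\<ge>T1. a \<le> x t" "\<forall>t\<ge>T2. x t \<le> P"
      using lo up unfolding eventually_at_top_linorder by blast
    then show thesis by (intro that[of "max 0 (max T1 T2)"]) auto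
  qed
  have gP: "g P \<le> K" using g_le_K \<open>K \<le> P\<close> by simp
  have below: "min (g a) K \<le> g (x t)" if "T \<le> t" "x t \<le> K" for t
    using g_ge_min_ends[of a "x t" K] T that a g_K by simp
  show ?thesis
  proof (cases "\<forall>\<^sub>F t in at_top. x t < K")
    case True
    then obtain S where S: "\<And>t. S \<le> t \<Longrightarrow> x t < K"
      unfolding eventually_at_top_linorder by blast
    define s where "s = max T S + \<tau>"
    define m where "m = min (g a) K"
    have ev: "m + exp (- \<mu> * (t - s)) * (x s - m) \<le> x t" if "s \<le> t" for t
      unfolding m_def
      using that T tau by (intro solution_relaxes_lower below less_imp_le[OF S]) (auto simp: s_def)
    have "((\<lambda>t. m + exp (- \<mu> * (t - s)) * (x s - m)) \<longlongrightarrow> m + 0 * (x s - m)) at_top"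
    proof (intro tendsto_intros filterlim_compose[OF exp_at_bot])
      show "filterlim (\<lambda>t. - \<mu> * (t - s)) at_bot at_top"
        using mu by real_asymp
    qed
    moreover have "c < m"
      using c damped_le_K[OF gP] by (auto simp: m_def)
    ultimately have "\<forall>\<^sub>F t in at_top. c < m + exp (- \<mu> * (t - s)) * (x s - m)"
      by (intro order_tendstoD) auto
    with eventually_ge_at_top[of s] show ?thesis
      by eventually_elim (use ev in force)
  next
    case False
    then obtain s where s: "T + \<tau> \<le> s" "K \<le> x s"
      unfolding eventually_at_top_linorder by (meson not_less)
    have "c \<le> x t" if "s \<le> t" for t
    proof (rule excursion_lower[where b = "\<lambda>u. g (x (u - \<tau>))" and y = x and c' = "min (g a) K"
          and K = K and c = "min (g a) (g P)" and s = s])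
      show "continuous_on {s..t} x"
        using tau s T by (intro x_cont_on) auto
      show "(x has_real_derivative \<mu> * (g (x (u - \<tau>)) - x u)) (at u)" if "s < u" for u
        using s T that tau by (intro x_der) auto
      show "min (g a) (g P) \<le> g (x (u - \<tau>))" if "s < u" for u
        using a T s that by (intro g_ge_min_ends) auto
      show "min (g a) K \<le> g (x (u - \<tau>))" if "s + \<tau> < u" "x (u - \<tau>) \<le> K" for u
        using that s tau by (intro below) auto
      show "c \<le> min (g a) K" using c damped_le_K[OF gP] by auto
      \<comment> \<open>The level for the first delay is \<open>damped\<close> of whichever endpoint has the smaller target.\<close>
      have "min (g a) (g P) + exp (- \<mu> * \<tau>) * (K - min (g a) (g P)) \<in> {damped a, damped P}"
        by (auto simp: damped_def min_def)
      then show "c \<le> min (g a) (g P) + exp (- \<mu> * \<tau>) * (K - min (g a) (g P))"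
        using c by auto
    qed (use mu tau s that gP in auto)
    then show ?thesis by (rule eventually_at_top_linorderI[of s])
  qed
qed

text \<open>The supremum \<open>m\<close> of the eventual lower bounds is the lower limit of the solution. If
  \<open>m \<le> x0\<close>, the improved bound exceeds \<open>m\<close> at \<open>a = m\<close>, hence by continuity also at some
  \<open>a < m\<close>, which is an eventual lower bound.\<close>

theorem eventually_above_critical_point:
  assumes "x0 < damped (damped x0)"
  shows "\<forall>\<^sub>F t in at_top. x0 < x t"
proof (cases "\<forall>\<^sub>F t in at_top. K < x t")
  case True
  then show ?thesis by eventually_elim (use x0_less_K in simp)
next
  case False
  define P where "P = damped x0"
  have up: "\<forall>\<^sub>F t in at_top. x t \<le> P"
    using eventually_le_damped_peak[OF False] by (simp add: P_def)
  have KP: "K \<le> P" unfolding P_def by (intro K_le_damped K_le_peak)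
  define S where "S = {a. \<forall>\<^sub>F t in at_top. a \<le> x t}"
  obtain \<delta> where \<delta>: "0 < \<delta>" "\<delta> \<in> S"
    using eventually_bounded_away_from_zero unfolding S_def by blast
  have bdd: "bdd_above S"
  proof (rule bdd_aboveI[of _ P])
    fix a assume "a \<in> S"
    then have "\<forall>\<^sub>F t in at_top. a \<le> x t" by (simp add: S_def)
    with up have "\<forall>\<^sub>F t :: real in at_top. a \<le> P" by eventually_elim simp
    then show "a \<le> P" by simp
  qed
  define m where "m = Sup S"
  have "\<delta> \<le> m" unfolding m_def using \<delta> bdd by (intro cSup_upper)
  have "x0 < m"
  proof (rule ccontr)
    assume "\<not> x0 < m"
    then have m: "0 < m" "m \<le> x0" using \<open>\<delta> \<le> m\<close> \<delta> by auto
    define h where "h = (\<lambda>a. min (g a) (min (damped a) (damped P)))"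
    have "m < g m" using m x0_less_K by (intro g_above) auto
    then have "m < h m"
      using m x0_less_K less_damped[of m m] assms by (auto simp: h_def P_def)
    have "continuous_on {0<..} h"
      unfolding h_def damped_def
      by (intro continuous_intros continuous_on_subset[OF g_cont]) auto
    then have "isCont h m"
      using m by (simp add: continuous_on_eq_continuous_at)
    then have "(h \<longlongrightarrow> h m) (at_left m)"
      by (simp add: isCont_def filterlim_at_split)
    then have "\<forall>\<^sub>F a in at_left m. m < h a"
      using \<open>m < h m\<close> by (rule order_tendstoD)
    moreover have "\<forall>\<^sub>F a in at_left m. a \<in> {0<..<m}"
      using m by (intro eventually_at_left_real)
    ultimately have "\<forall>\<^sub>F a in at_left m. 0 < a \<and> a < m \<and> m < h a"
      by eventually_elim simp
    then obtain a where a: "0 < a" "a < m" "m < h a"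
      using eventually_happens[of _ "at_left m"] by (auto simp: trivial_limit_at_left_real)
    obtain a' where "a' \<in> S" "a < a'"
      using less_cSupE[of a S] a \<delta> unfolding m_def by auto
    then have "\<forall>\<^sub>F t in at_top. a' \<le> x t" by (simp add: S_def)
    then have lo: "\<forall>\<^sub>F t in at_top. a \<le> x t"
      by eventually_elim (use \<open>a < a'\<close> in simp)
    obtain c where c: "m < c" "c < h a" using dense a by blast
    have "c \<in> S"
      using lower_bound_improves[OF up KP lo] a m c by (simp add: S_def h_def)
    then have "c \<le> m" unfolding m_def using bdd by (intro cSup_upper)
    with c show False by simp
  qed
  then obtain a where "a \<in> S" "x0 < a"
    using less_cSupE[of x0 S] \<delta> unfolding m_def by auto
  then have "\<forall>\<^sub>F t in at_top. a \<le> x t" by (simp add: S_def)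
  then show ?thesis
    by eventually_elim (use \<open>x0 < a\<close> in simp)
qed

end

section \<open>Consequences of condition (U)\<close>

lemma condition_U_critical_point:
  assumes "condition_U f x0"
  shows "0 < x0"
    and "\<And>y. 0 \<le> y \<Longrightarrow> y < x0 \<Longrightarrow> 0 < half_deriv f y"
    and "\<And>y. x0 < y \<Longrightarrow> half_deriv f y < 0"
proof -
  have "unimodal_critical_point f x0"
    using assms by (simp add: condition_U_def)
  then show "0 < x0"
    and "\<And>y. 0 \<le> y \<Longrightarrow> y < x0 \<Longrightarrow> 0 < half_deriv f y"
    and "\<And>y. x0 < y \<Longrightarrow> half_deriv f y < 0"
    by (simp_all add: unimodal_critical_point_def)
qed

lemma condition_U_has_derivative:
  assumes "condition_U f x0" "0 \<le> y"
  shows "(f has_real_derivative half_deriv f y) (at y within {0..})"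
proof -
  obtain D where D: "(f has_real_derivative D) (at y within {0..})"
    using assms by (auto simp: condition_U_def real_differentiable_def)
  then show ?thesis using half_deriv_eq[OF D assms(2)] by simp
qed

lemma condition_U_DERIV:
  assumes "condition_U f x0" "0 < y"
  shows "(f has_real_derivative half_deriv f y) (at y)"
proof -
  have "at y within {0..} = at y"
    using assms by (intro at_within_interior) auto
  then show ?thesis using condition_U_has_derivative[of f x0 y] assms by simp
qed

lemma condition_U_strict_incr:
  assumes U: "condition_U f x0" and cont: "continuous_on {0..} f" and "0 \<le> y" "y < z" "z \<le> x0"
  shows "f y < f z"
proof (rule DERIV_pos_imp_increasing_open[OF \<open>y < z\<close>])
  fix u assume "y < u" "u < z"
  then have "0 < half_deriv f u" "0 < u"
    using condition_U_critical_point(2)[OF U, of u] assms by auto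
  then show "\<exists>D. (f has_real_derivative D) (at u) \<and> 0 < D"
    using condition_U_DERIV[OF U] by blast
qed (use assms in \<open>auto intro: continuous_on_subset[OF cont]\<close>)

lemma condition_U_strict_decr:
  assumes U: "condition_U f x0" and cont: "continuous_on {0..} f" and "x0 \<le> y" "y < z"
  shows "f z < f y"
proof (rule DERIV_neg_imp_decreasing_open[OF \<open>y < z\<close>])
  have "0 < x0" by (rule condition_U_critical_point[OF U])
  then show "continuous_on {y..z} f"
    using assms by (auto intro: continuous_on_subset[OF cont])
  fix u assume "y < u" "u < z"
  then have "half_deriv f u < 0" "0 < u"
    using condition_U_critical_point(3)[OF U, of u] assms \<open>0 < x0\<close> by auto
  then show "\<exists>D. (f has_real_derivative D) (at u) \<and> D < 0"
    using condition_U_DERIV[OF U] by blast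
qed

text \<open>On the decreasing branch, positivity holds because \<open>f\<close> is nonnegative further to the right.\<close>

lemma condition_U_pos:
  assumes U: "condition_U f x0" and cont: "continuous_on {0..} f" and "0 < y"
  shows "0 < f y"
proof (cases "y \<le> x0")
  case True
  then show ?thesis
    using condition_U_strict_incr[OF U cont, of 0 y] U assms by (simp add: condition_U_def)
next
  case False
  then have "f (y + 1) < f y" by (intro condition_U_strict_decr[OF U cont]) auto
  moreover have "0 \<le> f (y + 1)" using U assms by (simp add: condition_U_def)
  ultimately show ?thesis by simp
qed

text \<open>A graph that leaves the origin above the diagonal can only return to it at a fixed point.\<close>

lemma above_diagonal_before_fixed_point:
  fixes g :: "real \<Rightarrow> real"
  assumes cont: "continuous_on {0..} g" and "g 0 = 0"
    and der: "(g has_real_derivative D) (at 0 within {0..})" and "1 < D"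
    and fixed_pt: "\<And>z. 0 < z \<Longrightarrow> g z = z \<Longrightarrow> K \<le> z"
    and "0 < y" "y < K"
  shows "y < g y"
proof (rule ccontr)
  assume "\<not> y < g y"
  have "((\<lambda>z. g z / z) \<longlongrightarrow> D) (at_right 0)"
    using der \<open>g 0 = 0\<close> by (simp add: has_field_derivative_iff at_within_Ici_at_right)
  then have "\<forall>\<^sub>F z in at_right 0. 1 < g z / z"
    using \<open>1 < D\<close> by (rule order_tendstoD)
  moreover have "\<forall>\<^sub>F z in at_right 0. z \<in> {0<..<y}"
    using \<open>0 < y\<close> by (intro eventually_at_right_real)
  ultimately have "\<forall>\<^sub>F z in at_right 0. 0 < z \<and> z < y \<and> z < g z"
    by eventually_elim (auto simp: field_simps)
  then obtain z where z: "0 < z" "z < y" "z < g z"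
    using eventually_happens[of _ "at_right (0::real)"] by auto
  have "\<exists>v\<ge>z. v \<le> y \<and> g v - v = 0"
    using z \<open>\<not> y < g y\<close>
    by (intro IVT2' continuous_intros continuous_on_subset[OF cont]) auto
  then obtain v where "z \<le> v" "v \<le> y" "g v = v" by auto
  with fixed_pt[of v] z \<open>y < K\<close> show False by simp
qed

theorem theorem8:
  fixes \<mu> \<tau> x0 K :: real and f :: "real \<Rightarrow> real"
  assumes "\<mu> > 0" and "\<tau> > 0"
    and "continuous_on {0..} f"
    and "condition_U f x0"
    and "half_deriv (gmap \<mu> f) 0 > 1"
    and "\<forall>y. y > 0 \<and> gmap \<mu> f y = y \<longleftrightarrow> y = K"
    and "K > x0"
    and "g1map \<mu> \<tau> f K (g1map \<mu> \<tau> f K x0) > x0"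
  shows "\<forall>\<phi> x. continuous_on {-\<tau>..0} \<phi> \<and> (\<forall>t\<in>{-\<tau>..0}. \<phi> t \<ge> 0) \<and> (\<exists>t\<in>{-\<tau>..0}. \<phi> t \<noteq> 0) \<and>
           dde_solution \<mu> \<tau> f \<phi> x \<longrightarrow> (\<forall>\<^sub>F t in at_top. x t > x0)"
proof (intro allI impI, elim conjE)
  fix \<phi> x
  assume nonneg: "\<forall>t\<in>{-\<tau>..0}. \<phi> t \<ge> 0" and nontrivial: "\<exists>t\<in>{-\<tau>..0}. \<phi> t \<noteq> 0"
    and sol: "dde_solution \<mu> \<tau> f \<phi> x"
  let ?g = "gmap \<mu> f"
  note cont = assms(3) and U = assms(4)
  have x0: "0 < x0" by (rule condition_U_critical_point[OF U])
  have K: "0 < K" "?g K = K" using assms(6) by auto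
  have g_cont: "continuous_on {0..} ?g"
    unfolding gmap_def by (intro continuous_intros cont)
  have g_der: "(?g has_real_derivative inverse \<mu> * half_deriv f 0) (at 0 within {0..})"
    unfolding gmap_def by (intro DERIV_cmult condition_U_has_derivative[OF U]) simp
  interpret unimodal_delay \<mu> \<tau> x0 K ?g x
  proof
    show "0 \<le> ?g y" if "0 \<le> y" for y
      using U that \<open>\<mu> > 0\<close> by (simp add: gmap_def condition_U_def)
    show "0 < ?g y" if "0 < y" for y
      using condition_U_pos[OF U cont that] \<open>\<mu> > 0\<close> by (simp add: gmap_def)
    show "?g y \<le> ?g z" if "0 \<le> y" "y \<le> z" "z \<le> x0" for y z
      using condition_U_strict_incr[OF U cont, of y z] that \<open>\<mu> > 0\<close>
      by (cases "y = z") (auto simp: gmap_def)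
    show "?g z \<le> ?g y" if "x0 \<le> y" "y \<le> z" for y z
      using condition_U_strict_decr[OF U cont, of y z] that \<open>\<mu> > 0\<close>
      by (cases "y = z") (auto simp: gmap_def)
    show "y < ?g y" if "0 < y" "y < K" for y
    proof (rule above_diagonal_before_fixed_point[OF g_cont _ g_der])
      show "?g 0 = 0" using U by (simp add: gmap_def condition_U_def)
      show "1 < inverse \<mu> * half_deriv f 0" using half_deriv_eq[OF g_der] assms(5) by simp
      show "K \<le> z" if "0 < z" "?g z = z" for z
        using spec[OF assms(6), of z] that by (metis order_refl)
    qed (fact that)+
    show "(x has_real_derivative \<mu> * (?g (x (t - \<tau>)) - x t)) (at t)" if "0 < t" for t
    proof -
      have "\<mu> * (?g (x (t - \<tau>)) - x t) = - \<mu> * x t + f (x (t - \<tau>))"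
        using \<open>\<mu> > 0\<close> by (simp add: gmap_def field_simps)
      then show ?thesis using sol that by (simp add: dde_solution_def)
    qed
    have init: "x t = \<phi> t" if "t \<in> {-\<tau>..0}" for t
      using sol that unfolding dde_solution_def by blast
    show "0 \<le> x t" if "-\<tau> \<le> t" "t \<le> 0" for t
      using init[of t] nonneg that by simp
    show "\<exists>t\<in>{-\<tau>..0}. x t \<noteq> 0"
      using init nontrivial by metis
    show "continuous_on {-\<tau>..} x"
      using sol unfolding dde_solution_def by blast
  qed (fact assms x0 K g_cont)+
  have "g1map \<mu> \<tau> f K y = damped y" for y
    by (simp add: g1map_def damped_convex)
  then show "\<forall>\<^sub>F t in at_top. x t > x0"
    using eventually_above_critical_point assms(8) by simp
qed

end
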